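(* For every $n\in\mathbb{N}$, $$\prod_{k\in\mathrm{Reg}_n}\left(x-\exp(2\pi ik/n)\right)=\prod_{d\,\|\,n}\Phi_d(x),$$ as polynomials in $x$.
   Context: $\mathbb{N}=\{1,2,\ldots\}$. An integer $k$ is called regular (mod $n$) if there exists $y\in\mathbb{Z}$ with $k^2y\equiv k\pmod n$, and $\mathrm{Reg}_n=\{k\in\mathbb{N}:1\le k\le n,\ k\text{ is regular (mod }n)\}$. $d\,\|\,n$ means that $d$ is a unitary divisor of $n$, i.e. $d\ge1$, $d\mid n$ and $\gcd(d,n/d)=1$. $\Phi_n(x)=\prod_{1\le k\le n,\ \gcd(k,n)=1}(x-\exp(2\pi ik/n))$ is the $n$-th cyclotomic polynomial. *)

theory Defs
  imports Complex_Main "HOL-Computational_Algebra.Polynomial" "HOL-Number_Theory.Cong"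
begin

definition regular_mod :: "nat \<Rightarrow> int \<Rightarrow> bool" where
  "regular_mod n k \<longleftrightarrow> (\<exists>y::int. [k\<^sup>2 * y = k] (mod int n))"

definition Reg :: "nat \<Rightarrow> nat set" where
  "Reg n = {k. 1 \<le> k \<and> k \<le> n \<and> regular_mod n (int k)}"

definition unitary_dvd :: "nat \<Rightarrow> nat \<Rightarrow> bool" where
  "unitary_dvd d n \<longleftrightarrow> 1 \<le> d \<and> d dvd n \<and> gcd d (n div d) = 1"

definition cyclotomic :: "nat \<Rightarrow> complex poly" where
  "cyclotomic n =
     (\<Prod>k\<in>{k::nat. 1 \<le> k \<and> k \<le> n \<and> gcd k n = 1}.
        [:- exp (2 * complex_of_real pi * \<i> * of_nat k / of_nat n), 1:])"

end

theory Submission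
  imports Defs
begin

text \<open>
  Write \<open>k = g * j\<close> and \<open>n = g * d\<close> with \<open>g = gcd k n\<close>, so that \<open>j\<close> is coprime to \<open>d\<close>.
  Cancelling \<open>g * j\<close>, the congruence \<open>k\<^sup>2 * y \<equiv> k (mod n)\<close> becomes \<open>g * j * y \<equiv> 1 (mod d)\<close>,
  which is solvable iff \<open>g\<close> is coprime to \<open>d\<close>. Hence \<open>k\<close> is regular iff \<open>d\<close> is a unitary divisor
  of \<open>n\<close>. As \<open>k / n = j / d\<close>, grouping the regular \<open>k\<close> by \<open>d\<close> yields the cyclotomic factors.
\<close>

lemma regular_mod_mult_iff:
  fixes g d j :: nat
  assumes "g > 0" and "coprime j d"
  shows "regular_mod (g * d) (int (g * j)) \<longleftrightarrow> coprime g d"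
proof -
  have "[(int (g * j))\<^sup>2 * y = int (g * j)] (mod int (g * d))
          \<longleftrightarrow> [int (g * j) * y = 1] (mod int d)" for y
  proof -
    have "[(int (g * j))\<^sup>2 * y = int (g * j)] (mod int (g * d))
            \<longleftrightarrow> int g * int d dvd int g * (int j * (int (g * j) * y - 1))"
      by (simp add: cong_iff_dvd_diff power2_eq_square algebra_simps)
    \<comment> \<open>The two factors cancel for different reasons: \<open>g\<close> because it is
      nonzero and divides the modulus too, \<open>j\<close> in the next step because it is a unit
      mod \<open>d\<close>.\<close>
    also have "\<dots> \<longleftrightarrow> int d dvd int j * (int (g * j) * y - 1)"
      using assms(1) by simp
    also have "\<dots> \<longleftrightarrow> int d dvd int (g * j) * y - 1"
      using assms(2) by (intro coprime_dvd_mult_right_iff) (simp add: coprime_commute)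
    finally show ?thesis
      by (simp add: cong_iff_dvd_diff)
  qed
  \<comment> \<open>A suitable \<open>y\<close> is exactly an inverse of \<open>g * j\<close> mod
    \<open>d\<close>.\<close>
  then have "regular_mod (g * d) (int (g * j)) \<longleftrightarrow> coprime (int (g * j)) (int d)"
    unfolding regular_mod_def coprime_iff_invertible_int by simp
  also have "\<dots> \<longleftrightarrow> coprime g d"
    using assms(2) by (simp only: coprime_int_iff coprime_mult_left_iff simp_thms)
  finally show ?thesis .
qed

lemma unitary_dvdE:
  assumes "unitary_dvd d n" and "n > 0"
  obtains g where "n = g * d" "g > 0" "d > 0" "coprime g d" "n div d = g"
proof -
  from assms obtain g where "n = d * g"
    by (auto simp: unitary_dvd_def)
  with assms show ?thesis
    by (intro that[of g])
      (auto simp: unitary_dvd_def coprime_iff_gcd_eq_1 gcd.commute mult.commute)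
qed

lemma Reg_decompose:
  assumes "k \<in> Reg n" and "n > 0"
  obtains g d j where "k = g * j" "n = g * d" "gcd k n = g" "g > 0" "d > 0" "j > 0" "j \<le> d"
    "coprime j d" "coprime g d"
proof -
  define g where "g = gcd k n"
  obtain j d where kn: "k = j * g" "n = d * g" "coprime j d"
    using gcd_coprime_exists[of k n] assms(2) unfolding g_def by auto
  have *: "k = g * j" "n = g * d"
    using kn by simp_all
  have "g > 0" "d > 0"
    using assms(2) * by auto
  \<comment> \<open>Dividing \<open>1 \<le> k \<le> n\<close> by \<open>g\<close> puts
    \<open>j\<close> in the index range of \<open>cyclotomic d\<close>; the endpoint
    \<open>k = n\<close> corresponds to \<open>j = d = 1\<close>.\<close>
  moreover have "j > 0" "j \<le> d"
    using assms(1) * \<open>g > 0\<close> by (auto simp: Reg_def intro: Nat.gr0I)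
  moreover have "coprime g d"
    using assms(1) regular_mod_mult_iff[OF \<open>g > 0\<close> kn(3)] * by (simp add: Reg_def)
  ultimately show ?thesis
    by (intro that[of g j d] * kn(3) g_def[symmetric])
qed

theorem proposition5p7p1:
  fixes n :: nat
  assumes "n \<ge> 1"
  shows "(\<Prod>k\<in>Reg n. [:- exp (2 * complex_of_real pi * \<i> * of_nat k / of_nat n), 1:])
       = (\<Prod>d\<in>{d. unitary_dvd d n}. cyclotomic d)"
proof -
  define U where "U = {d. unitary_dvd d n}"
  define C where "C d = {k::nat. 1 \<le> k \<and> k \<le> d \<and> gcd k d = 1}" for d
  define F :: "nat \<Rightarrow> nat \<Rightarrow> complex poly"
    where "F d k = [:- exp (2 * complex_of_real pi * \<i> * of_nat k / of_nat d), 1:]" for d k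
  have n: "n > 0"
    using assms by simp
  have "finite U"
    by (rule finite_subset[of _ "{d. d dvd n}"]) (use n in \<open>auto simp: U_def unitary_dvd_def\<close>)
  moreover have "finite (C d)" for d
    by (rule finite_subset[of _ "{..d}"]) (auto simp: C_def)
  ultimately have "(\<Prod>d\<in>U. \<Prod>j\<in>C d. F d j) = (\<Prod>(d, j)\<in>Sigma U C. F d j)"
    by (intro prod.Sigma) auto
  also have "\<dots> = (\<Prod>k\<in>Reg n. F n k)"
  \<comment> \<open>One map reduces the fraction \<open>k / n\<close> to lowest terms
    \<open>j / d\<close>; the other expands \<open>j / d\<close> back to denominator
    \<open>n\<close>.\<close>
  proof (rule prod.reindex_bij_witness[where
        i = "\<lambda>k. (n div gcd k n, k div gcd k n)" and j = "\<lambda>(d, j). j * (n div d)"])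
    fix p assume "p \<in> Sigma U C"
    then obtain d j where p: "p = (d, j)" "unitary_dvd d n" "1 \<le> j" "j \<le> d" "coprime j d"
      by (auto simp: U_def C_def coprime_iff_gcd_eq_1)
    obtain g where g: "n = g * d" "g > 0" "d > 0" "coprime g d" "n div d = g"
      using unitary_dvdE[OF p(2) n] .
    \<comment> \<open>Since \<open>n = g * d\<close> and \<open>j\<close> is coprime to
      \<open>d\<close>, the common factor is exactly \<open>g\<close>, so reducing the expanded
      fraction recovers \<open>(d, j)\<close>.\<close>
    have gcd: "gcd (j * g) n = g"
      using p(5) g by (simp add: gcd_mult_distrib_nat[symmetric] mult.commute[of j] coprime_iff_gcd_eq_1)
    show "(\<lambda>k. (n div gcd k n, k div gcd k n)) ((\<lambda>(d, j). j * (n div d)) p) = p"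
      using gcd g p by simp
    show "(\<lambda>(d, j). j * (n div d)) p \<in> Reg n"
      using p g regular_mod_mult_iff[OF g(2) p(5)] by (simp add: Reg_def mult.commute)
    \<comment> \<open>Equal fractions give the same root of unity, hence the same linear
      factor.\<close>
    show "F n ((\<lambda>(d, j). j * (n div d)) p) = (\<lambda>(d, j). F d j) p"
      using p g by (simp add: F_def mult.assoc)
  next
    fix k assume "k \<in> Reg n"
    then obtain g d j where *: "k = g * j" "n = g * d" "gcd k n = g" "g > 0" "d > 0" "j > 0"
      "j \<le> d" "coprime j d" "coprime g d"
      using Reg_decompose[OF _ n] by metis
    have div: "n div gcd k n = d" "k div gcd k n = j" "n div d = g"
      using * by (simp_all only: *(3)) simp_all
    show "(\<lambda>(d, j). j * (n div d)) (n div gcd k n, k div gcd k n) = k"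
      using div *(1) by simp
    show "(n div gcd k n, k div gcd k n) \<in> Sigma U C"
      unfolding div using * div(3)
      by (auto simp: U_def C_def unitary_dvd_def coprime_iff_gcd_eq_1 gcd.commute)
  qed
  finally show ?thesis
    by (simp add: U_def C_def F_def cyclotomic_def)
qed

end
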